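(* Let $n\ge 1$, let $W\in\mathbb{R}^{N\times N}$ be an adjacency matrix, let $c>0$ be a constant, and let $L_1,\dots,L_n\in\mathbb{R}^{N\times N}$ be weighted directed graph Laplacians with $L_k\in\mathcal{A}^1(W,c)$ for every $k$. Consider the serial consensus controller $$U(s)=U_{\mathrm{ref}}(s)+\left(s^nI-\prod_{k=1}^n(sI+L_k)\right)X(s).$$ Then this controller is an $n$-step implementable relative feedback controller with respect to $W$ and some finite gain $c'$.
   Context: An adjacency matrix is an entrywise nonnegative matrix $W\in\mathbb{R}^{N\times N}$ (with $w_{i,j}>0$ if and only if $(j,i)$ is an edge of the graph). A weighted directed graph Laplacian $L$ associated with nonnegative weights $w_{i,j}$ has entries $[L]_{i,j}=-w_{i,j}$ for $i\neq j$ and $[L]_{i,i}=\sum_{k\ne i}w_{i,k}$. $\mathbf{1}_N$ is the all-ones vector in $\mathbb{R}^N$ and $\|\cdot\|_\infty$ is the induced matrix infinity norm. For an integer $q\ge 0$ and $c>0$, $$\mathcal{A}^q(W,c)=\left\{A\in\mathbb{R}^{N\times N}\ :\ \left[\sum_{k=0}^{q}W^k\right]_{i,j}=0\implies A_{i,j}=0\ \text{(for all } i,j),\quad A\mathbf{1}_N=0,\quad \|A\|_\infty\le c\right\}.$$ The agents obey $\frac{\mathrm{d}^n x_i(t)}{\mathrm{d}t^n}=u_i(t)$, $i=1,\dots,N$. A linear state feedback controller is of the form $u(t)=u_{\mathrm{ref}}(t)-\sum_{k=0}^{n-1}A_kx^{(k)}(t)$ with $A_k\in\mathbb{R}^{N\times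 N}$; in the Laplace domain, $U(s)=U_{\mathrm{ref}}(s)-\sum_{k=0}^{n-1}s^kA_kX(s)$. It is called a $q$-step implementable relative feedback controller with respect to $W$ and gain $c>0$ if $A_k\in\mathcal{A}^q(W,c)$ for all $k\in\{0,\dots,n-1\}$. Matrix products $\prod_{k=1}^n$ are ordered, with the factor $k=1$ leftmost. *)

theory Defs
  imports "HOL-Analysis.Analysis"
begin

text \<open>Matrix powers for the product \<open>**\<close>. (The class operation \<open>^\<close> on
  \<open>real^'n^'n\<close> would be the entrywise power.)\<close>

primrec mat_power :: "'a::semiring_1^'n^'n \<Rightarrow> nat \<Rightarrow> 'a^'n^'n" where
  "mat_power M 0 = mat 1"
| "mat_power M (Suc k) = M ** mat_power M k"

text \<open>\<open>mat_prod M n = M 1 ** M 2 ** \<dots> ** M n\<close>, with the factor of index 1 leftmost.\<close>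

primrec mat_prod :: "(nat \<Rightarrow> 'a::semiring_1^'n^'n) \<Rightarrow> nat \<Rightarrow> 'a^'n^'n" where
  "mat_prod M 0 = mat 1"
| "mat_prod M (Suc k) = mat_prod M k ** M (Suc k)"

text \<open>The matrix norm induced by the maximum norm on vectors; the supremum is formed as in
  \<^const>\<open>onorm\<close>, the quotient being 0 at \<open>x = 0\<close>.\<close>

definition induced_infnorm :: "real^'n^'n \<Rightarrow> real" where
  "induced_infnorm A = (SUP x. infnorm (A *v x) / infnorm x)"

lemma bdd_above_induced_infnorm:
  "bdd_above (range (\<lambda>x. infnorm ((A::real^'n^'n) *v x) / infnorm x))"
proof -
  obtain B where B: "\<And>x. norm (A *v x) \<le> B * norm x" "B>0"
    using linear_bounded_pos[OF matrix_vector_mul_linear[of A]] by blast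
  let ?S = "sqrt (DIM(real^'n))"
  have "infnorm (A *v x) / infnorm x \<le> B * ?S" for x
  proof (cases "x=0")
    case True then show ?thesis using B by (simp add: infnorm_0)
  next
    case False
    then have p: "infnorm x > 0" by (simp add: infnorm_pos_lt)
    have "infnorm (A *v x) \<le> norm (A *v x)" by (rule infnorm_le_norm)
    also have "\<dots> \<le> B * norm x" by (rule B)
    also have "\<dots> \<le> B * (?S * infnorm x)" using B(2) norm_le_infnorm[of x] by (intro mult_left_mono) auto
    finally show ?thesis using p by (simp add: field_simps)
  qed
  then show ?thesis by (auto intro!: bdd_aboveI)
qed

definition adjacency_matrix :: "real^'n^'n \<Rightarrow> bool" where
  "adjacency_matrix W \<longleftrightarrow> (\<forall>i j. 0 \<le> W $ i $ j)"

definition laplacian :: "real^'n^'n \<Rightarrow> real^'n^'n" where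
  "laplacian w = (\<chi> i j. if i = j then (\<Sum>k\<in>UNIV - {i}. w $ i $ k) else - (w $ i $ j))"

definition weighted_laplacian :: "real^'n^'n \<Rightarrow> bool" where
  "weighted_laplacian L \<longleftrightarrow> (\<exists>w. (\<forall>i j. 0 \<le> w $ i $ j) \<and> L = laplacian w)"

text \<open>The constant \<open>1 :: real^'n\<close> is the all-ones vector.\<close>

definition step_matrices :: "nat \<Rightarrow> real^'n^'n \<Rightarrow> real \<Rightarrow> (real^'n^'n) set" where
  "step_matrices q W c =
     {A. (\<forall>i j. (\<Sum>k\<le>q. mat_power W k) $ i $ j = 0 \<longrightarrow> A $ i $ j = 0) \<and>
         A *v 1 = 0 \<and> induced_infnorm A \<le> c}"

text \<open>A controller in the Laplace domain maps the transforms of the reference input and of the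
  state to the transform of the input: \<open>U = C Uref X\<close>. Real matrices act on
  complex-valued transforms through \<open>map_matrix complex_of_real\<close>, and \<open>mat s\<close> is \<open>s I\<close>.\<close>

type_synonym 'n controller =
  "(complex \<Rightarrow> complex^'n) \<Rightarrow> (complex \<Rightarrow> complex^'n) \<Rightarrow> complex \<Rightarrow> complex^'n"

definition state_feedback_controller :: "nat \<Rightarrow> (nat \<Rightarrow> real^'n^'n) \<Rightarrow> 'n controller" where
  "state_feedback_controller n A Uref X s =
     Uref s - (\<Sum>k<n. s ^ k *s (map_matrix complex_of_real (A k) *v X s))"

definition implementable_relative_feedback ::
    "nat \<Rightarrow> nat \<Rightarrow> real^'n^'n \<Rightarrow> real \<Rightarrow> 'n controller \<Rightarrow> bool" where
  "implementable_relative_feedback n q W c C \<longleftrightarrow>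
     0 < c \<and> (\<exists>A. (\<forall>k<n. A k \<in> step_matrices q W c) \<and> C = state_feedback_controller n A)"

definition serial_consensus_controller :: "nat \<Rightarrow> (nat \<Rightarrow> real^'n^'n) \<Rightarrow> 'n controller" where
  "serial_consensus_controller n L Uref X s =
     Uref s + (mat (s ^ n) - mat_prod (\<lambda>k. mat s + map_matrix complex_of_real (L k)) n) *v X s"

end

theory Submission
  imports Defs
begin

text \<open>The product \<open>(s I + L\<^sub>1) \<dots> (s I + L\<^sub>n)\<close> is a polynomial in \<open>s\<close> with real matrix
  coefficients. Its leading coefficient is the identity, which is cancelled by the \<open>s\<^sup>n I\<close> of the
  controller, so the remaining coefficients, those of \<open>s\<^sup>0, \<dots>, s\<^sup>n\<^sup>-\<^sup>1\<close>, are the feedback matrices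
  \<open>A\<^sub>k\<close> (lemma \<open>mat_prod_shift_mult_vec\<close>). Each of these is a sum of products of between 1 and
  \<open>n\<close> of the matrices \<open>L\<^sub>i\<close>. Having at least one factor, and hence a rightmost one, such a product
  annihilates \<open>1\<close> (\<open>prod_coeff_mult_one\<close>). Having at most \<open>n\<close> factors, each of which moves
  information along at most one edge, it moves information along walks of at most \<open>n\<close> edges only
  (\<open>sparse_within_prod_coeff\<close>). The walk argument rests on \<open>W\<close> being nonnegative: the entry
  \<open>(i,j)\<close> of \<open>\<Sum>k\<le>q. W\<^sup>k\<close> cannot vanish by cancellation, so it is zero exactly if no such walk of
  length at most \<open>q\<close> exists, and concatenation of walks makes the sparsity degrees add up under
  matrix multiplication (\<open>sparse_within_mult\<close>). The gain is no restriction, because finitely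
  many matrices have a common bound on their norms.\<close>

section \<open>Sparsity relative to a nonnegative matrix\<close>

definition sparse_within :: "nat \<Rightarrow> real^'n^'n \<Rightarrow> real^'n^'n \<Rightarrow> bool" where
  "sparse_within q W A \<longleftrightarrow>
     (\<forall>i j. (\<Sum>k\<le>q. mat_power W k) $ i $ j = 0 \<longrightarrow> A $ i $ j = 0)"

lemma step_matrices_iff:
  "A \<in> step_matrices q W c \<longleftrightarrow> sparse_within q W A \<and> A *v 1 = 0 \<and> induced_infnorm A \<le> c"
  by (simp add: step_matrices_def sparse_within_def)

lemma mat_power_add: "mat_power M (a + b) = mat_power M a ** mat_power M b"
  by (induction a) (simp_all add: matrix_mul_assoc)

lemma mat_power_nonneg:
  assumes "adjacency_matrix W"
  shows "0 \<le> mat_power W k $ i $ j"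
proof (induction k arbitrary: i j)
  case 0
  show ?case by (simp add: mat_def)
next
  case (Suc k)
  have "0 \<le> W $ i $ l" for l
    using assms by (simp add: adjacency_matrix_def)
  with Suc show ?case
    by (simp add: matrix_matrix_mult_def sum_nonneg)
qed

text \<open>Without cancellation, the vanishing of a sum of powers is a condition on each power: there is
  no walk of length at most \<open>q\<close> between the two vertices.\<close>

lemma sum_mat_power_eq_0_iff:
  assumes "adjacency_matrix W"
  shows "(\<Sum>k\<le>q. mat_power W k) $ i $ j = 0 \<longleftrightarrow> (\<forall>k\<le>q. mat_power W k $ i $ j = 0)"
  by (simp add: sum_nonneg_eq_0_iff mat_power_nonneg[OF assms] Ball_def)

lemma sparse_within_iff_walk:
  assumes "adjacency_matrix W"
  shows "sparse_within q W A \<longleftrightarrow>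
    (\<forall>i j. A $ i $ j \<noteq> 0 \<longrightarrow> (\<exists>k\<le>q. mat_power W k $ i $ j \<noteq> 0))"
  unfolding sparse_within_def sum_mat_power_eq_0_iff[OF assms] by blast

lemma sparse_within_mono:
  assumes "adjacency_matrix W" "sparse_within p W A" "p \<le> q"
  shows "sparse_within q W A"
  using assms(2,3) unfolding sparse_within_iff_walk[OF assms(1)] by (meson order_trans)

lemma sparse_within_0: "sparse_within q W 0"
  by (simp add: sparse_within_def)

lemma sparse_within_add:
  "sparse_within q W A \<Longrightarrow> sparse_within q W B \<Longrightarrow> sparse_within q W (A + B)"
  by (simp add: sparse_within_def)

lemma sparse_within_mat_1: "sparse_within 0 W (mat 1)"
  by (simp add: sparse_within_def)

lemma mat_power_concat_walk:
  assumes "adjacency_matrix W" "mat_power W a $ i $ l \<noteq> 0" "mat_power W b $ l $ j \<noteq> 0"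
  shows "mat_power W (a + b) $ i $ j \<noteq> 0"
proof -
  note nonneg = mat_power_nonneg[OF assms(1)]
  have "0 < mat_power W a $ i $ l * mat_power W b $ l $ j"
    using assms(2,3) nonneg by (simp add: less_le)
  also have "\<dots> \<le> (\<Sum>l\<in>UNIV. mat_power W a $ i $ l * mat_power W b $ l $ j)"
    by (rule member_le_sum) (simp_all add: nonneg)
  also have "\<dots> = mat_power W (a + b) $ i $ j"
    by (simp add: mat_power_add matrix_matrix_mult_def)
  finally show ?thesis by simp
qed

text \<open>A nonzero entry of a product needs an intermediate vertex joined to both ends, and walks
  through that vertex concatenate.\<close>

lemma sparse_within_mult:
  assumes W: "adjacency_matrix W" and A: "sparse_within p W A" and B: "sparse_within q W B"
  shows "sparse_within (p + q) W (A ** B)"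
  unfolding sparse_within_iff_walk[OF W]
proof (intro allI impI)
  fix i j
  assume "(A ** B) $ i $ j \<noteq> 0"
  then have "(\<Sum>l\<in>UNIV. A $ i $ l * B $ l $ j) \<noteq> 0"
    by (simp add: matrix_matrix_mult_def)
  then obtain l where "A $ i $ l * B $ l $ j \<noteq> 0"
    by (meson sum.neutral)
  then have "A $ i $ l \<noteq> 0" "B $ l $ j \<noteq> 0"
    by auto
  then obtain a b where "a \<le> p" "mat_power W a $ i $ l \<noteq> 0" "b \<le> q" "mat_power W b $ l $ j \<noteq> 0"
    using A B unfolding sparse_within_iff_walk[OF W] by blast
  then show "\<exists>k\<le>p + q. mat_power W k $ i $ j \<noteq> 0"
    using mat_power_concat_walk[OF W] add_mono by meson
qed

section \<open>Coefficients of the product of the shifted matrices\<close>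

text \<open>\<open>prod_coeff L m k\<close> is the coefficient of \<open>s\<^sup>k\<close> in \<open>(s I + L 1) \<dots> (s I + L m)\<close>; the
  recursion multiplies by the factor \<open>s I + L (Suc m)\<close> on the right.\<close>

primrec prod_coeff :: "(nat \<Rightarrow> 'a::semiring_1^'n^'n) \<Rightarrow> nat \<Rightarrow> nat \<Rightarrow> 'a^'n^'n" where
  "prod_coeff L 0 k = (if k = 0 then mat 1 else 0)"
| "prod_coeff L (Suc m) k =
     (case k of 0 \<Rightarrow> 0 | Suc k' \<Rightarrow> prod_coeff L m k') + prod_coeff L m k ** L (Suc m)"

lemma zero_matrix_mult [simp]: "(0 :: 'a::semiring_1^'n^'n) ** A = 0"
  by (simp add: matrix_matrix_mult_def vec_eq_iff)

lemma prod_coeff_eq_0: "m < k \<Longrightarrow> prod_coeff L m k = 0"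
  by (induction m arbitrary: k) (auto split: nat.split)

lemma prod_coeff_lead: "prod_coeff L m m = mat 1"
  by (induction m) (simp_all add: prod_coeff_eq_0)

text \<open>Except for the leading one, every coefficient collects products ending in some \<open>L i\<close>, so it
  inherits the kernel of the \<open>L i\<close>.\<close>

lemma prod_coeff_mult_one:
  fixes L :: "nat \<Rightarrow> 'a::comm_semiring_1^'n^'n"
  assumes "\<And>i. i \<in> {1..m} \<Longrightarrow> L i *v 1 = 0" "k < m"
  shows "prod_coeff L m k *v 1 = 0"
  using assms
proof (induction m arbitrary: k)
  case (Suc m)
  have "prod_coeff L m k' *v 1 = 0" if "k = Suc k'" for k'
    using Suc that by simp
  moreover have "(prod_coeff L m k ** L (Suc m)) *v 1 = 0"
    using Suc.prems(1) by (simp flip: matrix_vector_mul_assoc)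
  ultimately show ?case
    by (simp add: matrix_vector_mult_add_rdistrib split: nat.split)
qed simp

lemma sparse_within_prod_coeff:
  assumes W: "adjacency_matrix W" and "\<And>i. i \<in> {1..m} \<Longrightarrow> sparse_within 1 W (L i)"
  shows "sparse_within m W (prod_coeff L m k)"
  using assms(2)
proof (induction m arbitrary: k)
  case 0
  show ?case by (simp add: sparse_within_mat_1 sparse_within_0)
next
  case (Suc m)
  have IH: "sparse_within m W (prod_coeff L m k)" for k
    using Suc by simp
  have "sparse_within (Suc m) W (prod_coeff L m k')" for k'
    using sparse_within_mono[OF W IH] by simp
  moreover have "sparse_within (Suc m) W (prod_coeff L m k ** L (Suc m))"
    using sparse_within_mult[OF W IH Suc.prems, of "Suc m"] by simp
  ultimately show ?case
    by (auto intro!: sparse_within_add sparse_within_0 split: nat.split)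
qed

section \<open>The serial consensus controller as a state feedback\<close>

lemma map_matrix_of_real_mult:
  "map_matrix complex_of_real (A ** B) = map_matrix complex_of_real A ** map_matrix complex_of_real B"
  by (simp add: map_matrix_def matrix_matrix_mult_def vec_eq_iff)

lemma map_matrix_of_real_add:
  "map_matrix complex_of_real (A + B) = map_matrix complex_of_real A + map_matrix complex_of_real B"
  by (simp add: map_matrix_def vec_eq_iff)

lemma map_matrix_of_real_0: "map_matrix complex_of_real 0 = 0"
  by (simp add: map_matrix_def vec_eq_iff)

lemma map_matrix_of_real_mat_1: "map_matrix complex_of_real (mat 1) = mat 1"
  by (simp add: map_matrix_def mat_def vec_eq_iff)

lemma mat_mult_vec: "mat s *v x = s *s (x :: 'a::comm_semiring_1^'n)"
  by (simp add: mat_def matrix_vector_mult_def vec_eq_iff if_distrib if_distribR cong: if_cong)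

text \<open>The expansion is proved for the action on all vectors \<open>x\<close> at once: the rightmost factor acts
  on \<open>x\<close> first, and the induction hypothesis is then used at \<open>s x\<close> and at \<open>L\<^sub>m\<^sub>+\<^sub>1 x\<close>.\<close>

lemma mat_prod_shift_mult_vec:
  fixes L :: "nat \<Rightarrow> real^'n^'n"
  shows "mat_prod (\<lambda>k. mat s + map_matrix complex_of_real (L k)) m *v x =
    (\<Sum>k\<le>m. s ^ k *s (map_matrix complex_of_real (prod_coeff L m k) *v x))"
proof (induction m arbitrary: x)
  case 0
  show ?case by (simp add: map_matrix_of_real_mat_1)
next
  case (Suc m)
  let ?P = "mat_prod (\<lambda>k. mat s + map_matrix complex_of_real (L k))"
  let ?C = "\<lambda>m k. map_matrix complex_of_real (prod_coeff L m k)"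
  let ?L = "map_matrix complex_of_real (L (Suc m))"
  let ?shift = "\<lambda>k. map_matrix complex_of_real (case k of 0 \<Rightarrow> 0 | Suc k' \<Rightarrow> prod_coeff L m k')"
  have "?P (Suc m) *v x = ?P m *v (s *s x) + ?P m *v (?L *v x)"
    by (simp add: matrix_vector_mult_add_rdistrib matrix_vector_right_distrib mat_mult_vec
        flip: matrix_vector_mul_assoc)
  also have "?P m *v (s *s x) = (\<Sum>k\<le>m. s ^ Suc k *s (?C m k *v x))"
    unfolding Suc.IH
    by (intro sum.cong refl) (simp add: vector_scalar_commute vector_smult_assoc mult.commute)
  also have "\<dots> = (\<Sum>k\<le>Suc m. s ^ k *s (?shift k *v x))"
    by (subst sum.atMost_Suc_shift) (simp add: map_matrix_of_real_0)
  also have "?P m *v (?L *v x) = (\<Sum>k\<le>m. s ^ k *s ((?C m k ** ?L) *v x))"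
    unfolding Suc.IH by (simp add: matrix_vector_mul_assoc)
  \<comment> \<open>The range can be extended because the coefficient of \<open>s\<^sup>m\<^sup>+\<^sup>1\<close> is still zero.\<close>
  also have "\<dots> = (\<Sum>k\<le>Suc m. s ^ k *s ((?C m k ** ?L) *v x))"
    by (simp add: prod_coeff_eq_0 map_matrix_of_real_0)
  finally show ?case
    by (simp add: map_matrix_of_real_add map_matrix_of_real_mult matrix_vector_mult_add_rdistrib
        vector_add_ldistrib sum.distrib del: sum.atMost_Suc)
qed

lemma serial_consensus_eq_state_feedback:
  "serial_consensus_controller n L = state_feedback_controller n (prod_coeff L n)"
proof (intro ext)
  fix Uref X s
  have "{..n} = insert n {..<n}"
    by auto
  then show "serial_consensus_controller n L Uref X s =
      state_feedback_controller n (prod_coeff L n) Uref X s"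
    by (simp add: serial_consensus_controller_def state_feedback_controller_def
        matrix_vector_mult_diff_rdistrib mat_mult_vec mat_prod_shift_mult_vec
        prod_coeff_lead map_matrix_of_real_mat_1)
qed

theorem proposition1:
  fixes n :: nat and W :: "real^'n^'n" and c :: real and L :: "nat \<Rightarrow> real^'n^'n"
  assumes "1 \<le> n"
    and "adjacency_matrix W"
    and "0 < c"
    and "\<forall>k\<in>{1..n}. weighted_laplacian (L k) \<and> L k \<in> step_matrices 1 W c"
  shows "\<exists>c'>0. implementable_relative_feedback n n W c' (serial_consensus_controller n L)"
proof -
  let ?A = "prod_coeff L n"
  \<comment> \<open>The summand 1 only makes the gain strictly positive.\<close>
  define c' where "c' = 1 + (\<Sum>k<n. \<bar>induced_infnorm (?A k)\<bar>)"
  have "0 < c'"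
    unfolding c'_def by (intro add_pos_nonneg sum_nonneg) auto
  have L: "sparse_within 1 W (L i)" "L i *v 1 = 0" if "i \<in> {1..n}" for i
    using assms(4) that by (simp_all add: step_matrices_iff)
  have "?A k \<in> step_matrices n W c'" if "k < n" for k
  proof -
    have "\<bar>induced_infnorm (?A k)\<bar> \<le> (\<Sum>k<n. \<bar>induced_infnorm (?A k)\<bar>)"
      using that by (intro member_le_sum) auto
    then have "induced_infnorm (?A k) \<le> c'"
      by (simp add: c'_def)
    then show ?thesis
      using sparse_within_prod_coeff[OF assms(2) L(1)] prod_coeff_mult_one[OF L(2) that]
      by (simp add: step_matrices_iff)
  qed
  with \<open>0 < c'\<close> show ?thesis
    unfolding implementable_relative_feedback_def serial_consensus_eq_state_feedback by blast
qed

end
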